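(* $\mathsf{C}_{\mathbb{N}}\not\leq_{\mathsf{W}}\mathsf{OG\mapsto\alpha\epsilon}$, where $\mathsf{OG\mapsto\alpha\epsilon}$ is the problem which, given a countable ordered group $(G,\leq)$, outputs a copy of a well-order $\alpha$ and a bit $\epsilon\in\{0,1\}$ such that the order type of $G$ is $\mathbb{Z}^{\alpha}\mathbb{Q}^{\epsilon}$.
   Context: Weihrauch reducibility: a represented space is a set $X$ with a partial surjection $\delta_X:\subseteq\mathbb{N}^{\mathbb{N}}\to X$; if $\delta_X(p)=x$, $p$ is a name of $x$. A problem is a partial multi-valued function between represented spaces. $f\leq_{\mathsf{W}}g$ iff there are computable partial functions $\Phi,\Psi$ on Baire space such that whenever $p$ is a name of some $x\in\mathrm{dom}(f)$, $\Phi(p)$ is a name of some $z\in\mathrm{dom}(g)$, and for every name $q$ of an element of $g(z)$, $\Psi(p,q)$ is a name of an element of $f(x)$. Ordered groups: an ordered group is a group $G$ with a linear order $\leq$ such that $a\leq b$ implies $ag\leq bg$ and $ga\leq gb$ for all $g$. Countable ordered groups are presented on subsets of $\mathbb{N}$, a name coding the universe, operation and order. The order type of $G$ is a linear order $X$ such that there is an order-preserving bijection $G\to X$. For linear orders $X,Y$, the product $XY$ is $X\times Y$ with $\langle x_0,y_0\rangle<\langle x_1,y_1\rangle$ iff $y_0<y_1$, or $y_0=y_1$ and $x_0<x_1$. $\mathbb{Z}^X$ is the set of finitely supported functions $X\to\mathbb{Z}$, where for $f\neq g$, $f<g$ iff $f(x)<g(x)$ at the maximum $x$ where they differ. $\mathbb{Z}^\alpha\mathbb{Q}^0=\mathbb{Z}^\alpha$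 and $\mathbb{Z}^\alpha\mathbb{Q}^1=\mathbb{Z}^\alpha\mathbb{Q}$. By Maltsev's theorem every countable ordered group has order type $\mathbb{Z}^\alpha\mathbb{Q}^\epsilon$ for some ordinal $\alpha$ and $\epsilon\in\{0,1\}$. A copy of an ordinal $\alpha$ is a pair $(A,<_A)$ with $A\subseteq\mathbb{N}$, $<_A\subseteq A\times A$ a well-order of $A$ isomorphic to $\alpha$, coded in Baire space. $\mathsf{C}_{\mathbb{N}}$ (closed choice on $\mathbb{N}$): given an enumeration of the complement of a nonempty set $A\subseteq\mathbb{N}$, output an element of $A$. *)

theory Defs
  imports Complex_Main "HOL-Algebra.Group" "HOL-Library.Nat_Bijection"
begin

type_synonym baire = "nat \<Rightarrow> nat"


section \<open>Computable partial functions on Baire space\<close>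

text \<open>
  Programs for partial recursive functions relative to an oracle, and their (big-step) semantics:
  \<open>evaluates p e xs y\<close> says that the program \<open>e\<close> with oracle \<open>p\<close> halts on the arguments \<open>xs\<close>
  with value \<open>y\<close>.
\<close>

datatype program =
    Zero
  | Succ
  | Proj nat
  | Oracle
  | Comp program "program list"
  | PrimRec program program
  | Mu program

inductive evaluates :: "baire \<Rightarrow> program \<Rightarrow> nat list \<Rightarrow> nat \<Rightarrow> bool" for p where
  Zero: "evaluates p Zero xs 0"
| Succ: "evaluates p Succ [x] (Suc x)"
| Proj: "i < length xs \<Longrightarrow> evaluates p (Proj i) xs (xs ! i)"
| Oracle: "evaluates p Oracle [x] (p x)"
| Comp: "length ys = length gs \<Longrightarrow> (\<forall>i<length gs. evaluates p (gs ! i) xs (ys ! i))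
    \<Longrightarrow> evaluates p f ys z \<Longrightarrow> evaluates p (Comp f gs) xs z"
| PrimRec_0: "evaluates p f xs y \<Longrightarrow> evaluates p (PrimRec f g) (0 # xs) y"
| PrimRec_Suc: "evaluates p (PrimRec f g) (n # xs) y \<Longrightarrow> evaluates p g (n # y # xs) z
    \<Longrightarrow> evaluates p (PrimRec f g) (Suc n # xs) z"
| Mu: "evaluates p f (n # xs) 0 \<Longrightarrow> (\<forall>m<n. \<exists>y. evaluates p f (m # xs) (Suc y))
    \<Longrightarrow> evaluates p (Mu f) xs n"

text \<open>
  As usual in computable analysis, the program need only be correct on the domain of \<open>F\<close>;
  what it does elsewhere is irrelevant.
\<close>

definition computable :: "(baire \<rightharpoonup> baire) \<Rightarrow> bool" where
  "computable F \<longleftrightarrow> (\<exists>e. \<forall>p q. F p = Some q \<longrightarrow> (\<forall>n. evaluates p e [n] (q n)))"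

definition join :: "baire \<Rightarrow> baire \<Rightarrow> baire" where
  "join p q = (\<lambda>n. if even n then p (n div 2) else q (n div 2))"


section \<open>Represented spaces, problems and Weihrauch reducibility\<close>

text \<open>
  A represented space is given by its representation \<open>\<delta>\<close> alone; its underlying set is \<open>ran \<delta>\<close>,
  so that \<open>\<delta>\<close> is surjective onto the space by construction.
\<close>

type_synonym 'x representation = "baire \<rightharpoonup> 'x"

text \<open>
  A partial multi-valued function is a set-valued map, undefined where its value is empty.
\<close>

record ('x, 'y) problem =
  input_rep :: "'x representation"
  output_rep :: "'y representation"
  solutions :: "'x \<Rightarrow> 'y set"

definition problem_dom :: "('x, 'y) problem \<Rightarrow> 'x set" where
  "problem_dom f = {x \<in> ran (input_rep f). solutions f x \<noteq> {}}"

definition weihrauch_reducible :: "('x, 'y) problem \<Rightarrow> ('z, 'w) problem \<Rightarrow> bool"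
    (infix \<open>\<le>\<^sub>W\<close> 50) where
  "f \<le>\<^sub>W g \<longleftrightarrow>
    (\<exists>\<Phi> \<Psi>. computable \<Phi> \<and> computable \<Psi> \<and>
      (\<forall>p x. input_rep f p = Some x \<and> x \<in> problem_dom f \<longrightarrow>
        (\<exists>p' z. \<Phi> p = Some p' \<and> input_rep g p' = Some z \<and> z \<in> problem_dom g \<and>
          (\<forall>q w. output_rep g q = Some w \<and> w \<in> solutions g z \<longrightarrow>
            (\<exists>r y. \<Psi> (join p q) = Some r \<and> output_rep f r = Some y \<and> y \<in> solutions f x)))))"

definition nat_rep :: "nat representation" where
  "nat_rep p = Some (p 0)"

definition bit_rep :: "nat representation" where
  "bit_rep p = (if p 0 \<in> {0, 1} then Some (p 0) else None)"

text \<open>Sets of numbers and binary relations on numbers, represented by characteristic functions.\<close>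

definition set_rep :: "nat set representation" where
  "set_rep p = (if range p \<subseteq> {0, 1} then Some {n. p n = 1} else None)"

definition rel_rep :: "nat rel representation" where
  "rel_rep p = map_option (\<lambda>S. {(a, b). prod_encode (a, b) \<in> S}) (set_rep p)"

definition prod_rep :: "'x representation \<Rightarrow> 'y representation \<Rightarrow> ('x \<times> 'y) representation" where
  "prod_rep \<delta> \<delta>' p =
    (case (\<delta> (\<lambda>n. p (2 * n)), \<delta>' (\<lambda>n. p (2 * n + 1))) of
      (Some x, Some y) \<Rightarrow> Some (x, y)
    | _ \<Rightarrow> None)"

definition restrict_rep :: "('x \<Rightarrow> bool) \<Rightarrow> 'x representation \<Rightarrow> 'x representation" where
  "restrict_rep P \<delta> p = (case \<delta> p of Some x \<Rightarrow> if P x then Some x else None | None \<Rightarrow> None)"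


section \<open>Closed choice on the natural numbers\<close>

text \<open>The value \<open>0\<close> enumerates nothing, so that the complement may be empty.\<close>

definition co_enum_rep :: "nat set representation" where
  "co_enum_rep p = Some {n. Suc n \<notin> range p}"

definition C_N :: "(nat set, nat) problem" where
  "C_N = \<lparr>input_rep = co_enum_rep, output_rep = nat_rep, solutions = (\<lambda>A. A)\<rparr>"


section \<open>Linear orders\<close>

text \<open>A linear order is given by its universe and its strict order relation.\<close>

type_synonym 'a order_structure = "'a set \<times> 'a rel"

definition order_iso :: "'a order_structure \<Rightarrow> 'b order_structure \<Rightarrow> bool" (infix \<open>\<simeq>\<^sub>o\<close> 50) where
  "X \<simeq>\<^sub>o Y \<longleftrightarrow>
    (\<exists>f. bij_betw f (fst X) (fst Y) \<and>
      (\<forall>a \<in> fst X. \<forall>b \<in> fst X. (a, b) \<in> snd X \<longleftrightarrow> (f a, f b) \<in> snd Y))"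

definition strict_well_order :: "'a order_structure \<Rightarrow> bool" where
  "strict_well_order X \<longleftrightarrow>
    snd X \<subseteq> fst X \<times> fst X \<and> strict_linear_order_on (fst X) (snd X) \<and> wf (snd X)"

text \<open>In a product, the second coordinate is the more significant one.\<close>

definition order_prod ::
    "'a order_structure \<Rightarrow> 'b order_structure \<Rightarrow> ('a \<times> 'b) order_structure" where
  "order_prod X Y =
    (fst X \<times> fst Y,
     {((x0, y0), (x1, y1)). x0 \<in> fst X \<and> x1 \<in> fst X \<and> y0 \<in> fst Y \<and> y1 \<in> fst Y \<and>
        ((y0, y1) \<in> snd Y \<or> y0 = y1 \<and> (x0, x1) \<in> snd X)})"

text \<open>
  The order \<open>\<int>\<^sup>X\<close>. Functions on \<open>X\<close> are total functions vanishing off the universe of \<open>X\<close>.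
  In the order relation, \<open>x\<close> is the maximum at which \<open>f\<close> and \<open>g\<close> differ.
\<close>

definition fin_supp :: "'a set \<Rightarrow> ('a \<Rightarrow> int) set" where
  "fin_supp A = {f. finite {x. f x \<noteq> 0} \<and> {x. f x \<noteq> 0} \<subseteq> A}"

definition int_power :: "'a order_structure \<Rightarrow> ('a \<Rightarrow> int) order_structure" where
  "int_power X =
    (fin_supp (fst X),
     {(f, g). f \<in> fin_supp (fst X) \<and> g \<in> fin_supp (fst X) \<and>
        (\<exists>x \<in> fst X. f x < g x \<and> (\<forall>y \<in> fst X. (x, y) \<in> snd X \<longrightarrow> f y = g y))})"

definition rat_order :: "rat order_structure" where
  "rat_order = (UNIV, {(a, b). a < b})"

definition has_type_ZQ :: "'a order_structure \<Rightarrow> 'b order_structure \<Rightarrow> nat \<Rightarrow> bool" where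
  "has_type_ZQ X \<alpha> \<epsilon> \<longleftrightarrow>
    \<epsilon> = 0 \<and> X \<simeq>\<^sub>o int_power \<alpha> \<or>
    \<epsilon> = 1 \<and> X \<simeq>\<^sub>o order_prod (int_power \<alpha>) rat_order"


section \<open>Countable ordered groups\<close>

locale ordered_group = group G for G (structure) +
  fixes le :: "'a rel"
  assumes linear_order: "linear_order_on (carrier G) le"
    and left_mono: "\<lbrakk>(a, b) \<in> le; g \<in> carrier G\<rbrakk> \<Longrightarrow> (g \<otimes> a, g \<otimes> b) \<in> le"
    and right_mono: "\<lbrakk>(a, b) \<in> le; g \<in> carrier G\<rbrakk> \<Longrightarrow> (a \<otimes> g, b \<otimes> g) \<in> le"

text \<open>
  The group structure on a universe \<open>U\<close> whose operation is coded by \<open>m\<close>. Outside \<open>U\<close> the operation is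
  set to a default value, and the neutral element is recovered from the operation, so
  that structures with the same universe and the same operation are equal.
\<close>

definition decode_group :: "nat set \<Rightarrow> baire \<Rightarrow> nat monoid" where
  "decode_group U m =
    \<lparr>carrier = U,
     mult = (\<lambda>a b. if a \<in> U \<and> b \<in> U then m (prod_encode (a, b)) else 0),
     one = (THE e. e \<in> U \<and>
       (\<forall>a \<in> U. m (prod_encode (e, a)) = a \<and> m (prod_encode (a, e)) = a))\<rparr>"

definition ordered_group_rep :: "(nat monoid \<times> nat rel) representation" where
  "ordered_group_rep =
    restrict_rep (\<lambda>(G, le). ordered_group G le)
      (\<lambda>p. map_option (\<lambda>((U, m), le). (decode_group U m, le))
        (prod_rep (prod_rep set_rep Some) rel_rep p))"

definition well_order_copy_rep :: "nat order_structure representation" where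
  "well_order_copy_rep = restrict_rep strict_well_order (prod_rep set_rep rel_rep)"

text \<open>
  The well-order \<open>\<alpha>\<close> in the output is a well-ordered subset of \<open>nat\<close>, that is, a copy of the ordinal
  it is isomorphic to; \<open>\<int>\<^sup>\<alpha>\<close> depends on that ordinal only, up to isomorphism. By Maltsev's theorem
  every countable ordered group has a solution, so the domain is the whole input space.
\<close>

definition OG_to_alpha_eps :: "(nat monoid \<times> nat rel, nat order_structure \<times> nat) problem" where
  "OG_to_alpha_eps =
    \<lparr>input_rep = ordered_group_rep,
     output_rep = prod_rep well_order_copy_rep bit_rep,
     solutions = (\<lambda>(G, le). {(\<alpha>, \<epsilon>). strict_well_order \<alpha> \<and> \<epsilon> \<in> {0, 1} \<and>
       has_type_ZQ (carrier G, le - Id) \<alpha> \<epsilon>})\<rparr>"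

end

theory Submission
  imports Defs
begin

text \<open>
  The argument uses no group theory. Suppose that \<open>C_N\<close> reduces to the problem. Among
  the solutions arising from inputs of \<open>C_N\<close> with a given finite prefix, choose one whose well-order is
  of least size, all infinite sizes counting as equal. The number \<open>n\<close> computed from it depends only
  on finite prefixes of the input and of the solution. Extend the input prefix by enumerating \<open>n\<close> out
  of the closed set. By minimality, the well-order of any solution for such an extension has a copy
  which agrees with the old finite prefix, so if the bit \<open>\<epsilon>\<close> were unchanged, then \<open>n\<close> would be computed
  again, which is wrong. Thus one value of the bit is excluded for all further extensions. Doing this
  twice excludes both values.
\<close>

section \<open>Relative computations\<close>

text \<open>This turns two computations with the same oracle into an equation between their results.
  For \<open>Mu\<close>, of two distinct results the smaller would be a zero of \<open>f\<close> at
  a place where the other derivation demands a positive value.\<close>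

lemma evaluates_deterministic:
  assumes "evaluates p e xs y" and "evaluates p e xs z"
  shows "y = z"
  using assms
proof (induction arbitrary: z rule: evaluates.induct)
  case (Comp ys gs xs f w)
  from Comp.prems obtain zs where zs: "length zs = length gs"
      "\<forall>i<length gs. evaluates p (gs ! i) xs (zs ! i)" "evaluates p f zs z"
    by cases auto
  have "ys = zs"
    using Comp.hyps(1) Comp.IH(1) zs by (intro nth_equalityI) auto
  then show ?case using Comp.IH zs by blast
next
  case (PrimRec_0 f xs y g)
  from PrimRec_0.prems have "evaluates p f xs z" by cases
  then show ?case using PrimRec_0.IH by blast
next
  case (PrimRec_Suc f g n xs y w)
  from PrimRec_Suc.prems obtain y' where
    "evaluates p (PrimRec f g) (n # xs) y'" "evaluates p g (n # y' # xs) z" by cases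
  then show ?case using PrimRec_Suc.IH by blast
next
  case (Mu f n xs)
  from Mu.prems have z: "evaluates p f (z # xs) 0" "\<forall>m<z. \<exists>y. evaluates p f (m # xs) (Suc y)"
    by (cases; simp)+
  show ?case
  proof (rule linorder_cases[of n z])
    assume "n < z"
    then show ?thesis using z(2) Mu.IH(1) by blast
  next
    assume "z < n"
    then obtain y where "evaluates p f (z # xs) (Suc y)"
      "\<forall>w. evaluates p f (z # xs) w \<longrightarrow> Suc y = w"
      using Mu.IH(2) by blast
    then show ?thesis using z(1) by blast
  qed
qed (erule evaluates.cases; simp)+

section \<open>Finite use of the oracle\<close>

definition agree_below :: "nat \<Rightarrow> baire \<Rightarrow> baire \<Rightarrow> bool" where
  "agree_below N p q \<longleftrightarrow> (\<forall>i<N. p i = q i)"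

lemma agree_below_mono: "\<lbrakk>agree_below N p q; M \<le> N\<rbrakk> \<Longrightarrow> agree_below M p q"
  by (auto simp: agree_below_def)

lemma agree_below_refl [simp]: "agree_below N p p"
  by (simp add: agree_below_def)

text \<open>Position \<open>i\<close> of a join reads one component at \<open>i div 2\<close>, which
  is at most \<open>i\<close>.\<close>

lemma agree_below_join:
  "\<lbrakk>agree_below N p p'; agree_below N q q'\<rbrakk> \<Longrightarrow> agree_below N (join p q) (join p' q')"
  by (auto simp: agree_below_def join_def)

text \<open>Finitely many bounds have a maximum, and \<open>P\<close> is monotone in the bound. It
  collects the oracle use of the finitely many subcomputations of \<open>Comp\<close> and
  \<open>Mu\<close>.\<close>

lemma uniform_bound:
  fixes P :: "nat \<Rightarrow> nat \<Rightarrow> bool"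
  assumes "\<And>i. i < k \<Longrightarrow> \<exists>N. P i N" and "\<And>i M N. \<lbrakk>P i M; M \<le> N\<rbrakk> \<Longrightarrow> P i N"
  shows "\<exists>N. \<forall>i<k. P i N"
  using assms(1)
proof (induction k)
  case (Suc k)
  obtain M where M: "\<forall>i<k. P i M" using Suc.IH Suc.prems by (meson less_SucI)
  obtain N where N: "P k N" using Suc.prems by blast
  have "P i (max M N)" if "i < Suc k" for i
  proof (cases "i = k")
    case True
    then show ?thesis using N assms(2)[of k N] by simp
  next
    case False
    then have "P i M" using M that by simp
    then show ?thesis using assms(2)[of i M] by simp
  qed
  then show ?case by blast
qed simp

text \<open>A halting computation is a finite derivation, so it queries the oracle at finitely many
  places; \<open>N\<close> exceeds all of them.\<close>

lemma evaluates_continuous: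
  assumes "evaluates p e xs y"
  shows "\<exists>N. \<forall>p'. agree_below N p p' \<longrightarrow> evaluates p' e xs y"
  using assms
proof (induction rule: evaluates.induct)
  case (Oracle x)
  have "evaluates p' program.Oracle [x] (p x)" if "agree_below (Suc x) p p'" for p'
    using that evaluates.Oracle[of p' x] by (simp add: agree_below_def)
  then show ?case by blast
next
  case (Comp ys gs xs f z)
  have "\<exists>M. \<forall>i<length gs. \<forall>p'. agree_below M p p' \<longrightarrow> evaluates p' (gs ! i) xs (ys ! i)"
    using Comp.IH(1) by (intro uniform_bound) (auto intro: agree_below_mono)
  then obtain M where M:
      "\<forall>i<length gs. \<forall>p'. agree_below M p p' \<longrightarrow> evaluates p' (gs ! i) xs (ys ! i)" by blast
  obtain N where N: "\<forall>p'. agree_below N p p' \<longrightarrow> evaluates p' f ys z"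
    using Comp.IH(2) by blast
  have "evaluates p' (program.Comp f gs) xs z" if "agree_below (max M N) p p'" for p'
  proof (rule evaluates.Comp)
    show "length ys = length gs" by (rule Comp.hyps)
    show "\<forall>i<length gs. evaluates p' (gs ! i) xs (ys ! i)"
      using M agree_below_mono[OF that] by simp
    show "evaluates p' f ys z" using N agree_below_mono[OF that] by simp
  qed
  then show ?case by blast
next
  case (PrimRec_Suc f g n xs y z)
  obtain M where M: "\<forall>p'. agree_below M p p' \<longrightarrow> evaluates p' (PrimRec f g) (n # xs) y"
    using PrimRec_Suc.IH(1) by blast
  obtain N where N: "\<forall>p'. agree_below N p p' \<longrightarrow> evaluates p' g (n # y # xs) z"
    using PrimRec_Suc.IH(2) by blast
  have "evaluates p' (PrimRec f g) (Suc n # xs) z" if "agree_below (max M N) p p'" for p'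
    using M N agree_below_mono[OF that] by (meson evaluates.PrimRec_Suc max.cobounded1 max.cobounded2)
  then show ?case by blast
next
  case (Mu f n xs)
  \<comment> \<open>The value \<open>y\<close> is fixed before \<open>p'\<close> varies; in this
    form the condition on \<open>M\<close> is monotone, as \<open>uniform_bound\<close>
    requires.\<close>
  have "\<exists>M. \<forall>m<n. \<exists>y. \<forall>p'. agree_below M p p' \<longrightarrow> evaluates p' f (m # xs) (Suc y)"
    by (intro uniform_bound) (use Mu.IH(2) in blast, meson agree_below_mono)
  then obtain M where M:
      "\<forall>m<n. \<exists>y. \<forall>p'. agree_below M p p' \<longrightarrow> evaluates p' f (m # xs) (Suc y)" by blast
  obtain N where N: "\<forall>p'. agree_below N p p' \<longrightarrow> evaluates p' f (n # xs) 0"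
    using Mu.IH(1) by blast
  have "evaluates p' (program.Mu f) xs n" if "agree_below (max M N) p p'" for p'
  proof (rule evaluates.Mu)
    show "evaluates p' f (n # xs) 0" using N agree_below_mono[OF that] by simp
    show "\<forall>m<n. \<exists>y. evaluates p' f (m # xs) (Suc y)"
      using M agree_below_mono[OF that, of M] by (metis max.cobounded1)
  qed
  then show ?case by blast
qed (blast intro: evaluates.Zero evaluates.Succ evaluates.Proj evaluates.PrimRec_0)+

section \<open>Isomorphic copies of orders\<close>

lemma order_iso_trans:
  assumes "X \<simeq>\<^sub>o Y" and "Y \<simeq>\<^sub>o Z"
  shows "X \<simeq>\<^sub>o Z"
proof -
  obtain f g where "bij_betw f (fst X) (fst Y)" "bij_betw g (fst Y) (fst Z)"
      "\<forall>a \<in> fst X. \<forall>b \<in> fst X. (a, b) \<in> snd X \<longleftrightarrow> (f a, f b) \<in> snd Y"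
      "\<forall>a \<in> fst Y. \<forall>b \<in> fst Y. (a, b) \<in> snd Y \<longleftrightarrow> (g a, g b) \<in> snd Z"
    using assms by (auto simp: order_iso_def)
  then show ?thesis
    unfolding order_iso_def
    by (intro exI[of _ "g \<circ> f"]) (simp add: bij_betw_trans[of f _ _ g] bij_betw_apply[of f])
qed

lemma order_iso_sym:
  assumes "X \<simeq>\<^sub>o Y"
  shows "Y \<simeq>\<^sub>o X"
proof -
  obtain f where f: "bij_betw f (fst X) (fst Y)"
      "\<forall>a \<in> fst X. \<forall>b \<in> fst X. (a, b) \<in> snd X \<longleftrightarrow> (f a, f b) \<in> snd Y"
    using assms by (auto simp: order_iso_def)
  have "(a, b) \<in> snd Y \<longleftrightarrow> (inv_into (fst X) f a, inv_into (fst X) f b) \<in> snd X"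
    if "a \<in> fst Y" "b \<in> fst Y" for a b
    using f that bij_betw_inv_into_right[OF f(1)] bij_betw_apply[OF bij_betw_inv_into[OF f(1)]]
    by simp
  then show ?thesis
    using bij_betw_inv_into[OF f(1)] unfolding order_iso_def by blast
qed

text \<open>Functions pull back along an isomorphism \<open>h\<close> from \<open>X\<close> to
  \<open>Y\<close>, by composition with \<open>h\<close>; hence the reversed direction in the
  conclusion.\<close>

lemma int_power_cong:
  assumes "X \<simeq>\<^sub>o Y"
  shows "int_power Y \<simeq>\<^sub>o int_power X"
proof -
  obtain h where h: "bij_betw h (fst X) (fst Y)"
      and mono: "\<And>a b. \<lbrakk>a \<in> fst X; b \<in> fst X\<rbrakk> \<Longrightarrow> (a, b) \<in> snd X \<longleftrightarrow> (h a, h b) \<in> snd Y"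
    using assms by (auto simp: order_iso_def)
  let ?k = "inv_into (fst X) h"
  \<comment> \<open>The value 0 off the universe keeps the result in \<open>fin_supp\<close>, where
    functions on a subset are total functions vanishing outside it.\<close>
  let ?pull = "\<lambda>g x. if x \<in> fst X then g (h x) else (0::int)"
  let ?push = "\<lambda>f y. if y \<in> fst Y then f (?k y) else (0::int)"
  have k: "bij_betw ?k (fst Y) (fst X)" by (rule bij_betw_inv_into[OF h])
  note hk = bij_betw_inv_into_right[OF h] and kh = bij_betw_inv_into_left[OF h]
  note h_in = bij_betw_apply[OF h] and k_in = bij_betw_apply[OF k]
  have pull: "?pull g \<in> fin_supp (fst X)" if "g \<in> fin_supp (fst Y)" for g
  proof -
    have "{x. ?pull g x \<noteq> 0} \<subseteq> ?k ` {y. g y \<noteq> 0}"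
    proof
      fix x assume "x \<in> {x. ?pull g x \<noteq> 0}"
      then show "x \<in> ?k ` {y. g y \<noteq> 0}"
        using kh[of x] by (intro image_eqI[of _ _ "h x"]) (auto split: if_splits)
    qed
    moreover have "finite {y. g y \<noteq> 0}" using that by (simp add: fin_supp_def)
    ultimately have "finite {x. ?pull g x \<noteq> 0}" by (rule finite_subset[OF _ finite_imageI])
    then show ?thesis unfolding fin_supp_def by (simp; force)
  qed
  have push: "?push f \<in> fin_supp (fst Y)" if "f \<in> fin_supp (fst X)" for f
  proof -
    have "{y. ?push f y \<noteq> 0} \<subseteq> h ` {x. f x \<noteq> 0}"
    proof
      fix y assume "y \<in> {y. ?push f y \<noteq> 0}"
      then show "y \<in> h ` {x. f x \<noteq> 0}"
        using hk[of y] by (intro image_eqI[of _ _ "?k y"]) (auto split: if_splits)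
    qed
    moreover have "finite {x. f x \<noteq> 0}" using that by (simp add: fin_supp_def)
    ultimately have "finite {y. ?push f y \<noteq> 0}" by (rule finite_subset[OF _ finite_imageI])
    then show ?thesis unfolding fin_supp_def by (simp; force)
  qed
  have "bij_betw ?pull (fin_supp (fst Y)) (fin_supp (fst X))"
  proof (rule bij_betw_byWitness[where f' = ?push])
    show "\<forall>g\<in>fin_supp (fst Y). ?push (?pull g) = g"
    proof (intro ballI ext)
      fix g y assume "g \<in> fin_supp (fst Y)"
      then show "?push (?pull g) y = g y"
        using hk[of y] k_in[of y] by (auto simp: fin_supp_def)
    qed
    show "\<forall>f\<in>fin_supp (fst X). ?pull (?push f) = f"
    proof (intro ballI ext)
      fix f x assume "f \<in> fin_supp (fst X)"
      then show "?pull (?push f) x = f x"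
        using kh[of x] h_in[of x] by (auto simp: fin_supp_def)
    qed
  qed (use pull push in auto)
  moreover have "(f, g) \<in> snd (int_power Y) \<longleftrightarrow> (?pull f, ?pull g) \<in> snd (int_power X)"
    if "f \<in> fin_supp (fst Y)" "g \<in> fin_supp (fst Y)" for f g
  proof -
    have image: "fst Y = h ` fst X" using h by (simp add: bij_betw_def)
    \<comment> \<open>The maximal point of difference moves along \<open>h\<close>: write it as
      \<open>h x\<close>, and likewise the points above it.\<close>
    have "(\<exists>y\<in>fst Y. f y < g y \<and> (\<forall>z\<in>fst Y. (y, z) \<in> snd Y \<longrightarrow> f z = g z)) \<longleftrightarrow>
        (\<exists>x\<in>fst X. f (h x) < g (h x) \<and> (\<forall>z\<in>fst X. (x, z) \<in> snd X \<longrightarrow> f (h z) = g (h z)))"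
      unfolding image using mono by auto
    then show ?thesis
      using that pull[OF that(1)] pull[OF that(2)] by (simp add: int_power_def)
  qed
  ultimately show ?thesis
    unfolding order_iso_def by (intro exI[of _ ?pull]) (simp add: int_power_def)
qed

lemma order_prod_cong_left:
  assumes "X \<simeq>\<^sub>o X'"
  shows "order_prod X Y \<simeq>\<^sub>o order_prod X' Y"
proof -
  obtain f where f: "bij_betw f (fst X) (fst X')"
      "\<forall>a \<in> fst X. \<forall>b \<in> fst X. (a, b) \<in> snd X \<longleftrightarrow> (f a, f b) \<in> snd X'"
    using assms by (auto simp: order_iso_def)
  have "bij_betw (map_prod f id) (fst X \<times> fst Y) (fst X' \<times> fst Y)"
    using bij_betw_map_prod[OF f(1) bij_betw_id[of "fst Y"]] .
  then show ?thesis
    unfolding order_iso_def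
    by (intro exI[of _ "map_prod f id"]) (use f in \<open>auto simp: order_prod_def bij_betw_apply\<close>)
qed

text \<open>Solutions may be replaced by isomorphic copies, which gives the freedom to choose how
  the well-order sits inside the natural numbers.\<close>

lemma has_type_ZQ_cong:
  assumes "has_type_ZQ X \<alpha> \<epsilon>" and "\<beta> \<simeq>\<^sub>o \<alpha>"
  shows "has_type_ZQ X \<beta> \<epsilon>"
  using assms(1) int_power_cong[OF assms(2)] order_prod_cong_left[OF int_power_cong[OF assms(2)]]
  unfolding has_type_ZQ_def by (blast intro: order_iso_trans)

section \<open>Copies of a well-order with a prescribed finite part\<close>

lemma finite_linear_order_iso_lessThan:
  assumes "finite F" and "trans r" and "irrefl r" and "total_on F r"
  shows "(F, r) \<simeq>\<^sub>o ({..<card F}, {(a, b). a < b})"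
proof -
  \<comment> \<open>The position of \<open>x\<close> in \<open>F\<close>. Only predecessors inside
    \<open>F\<close> are counted, so \<open>r\<close> may be the order of a larger set.\<close>
  define rank where "rank x = card {z \<in> F. (z, x) \<in> r}" for x
  have less: "rank x < rank y" if "x \<in> F" "(x, y) \<in> r" for x y
    unfolding rank_def using that assms
    by (intro psubset_card_mono) (auto simp: irrefl_def elim: transD)
  have iff: "(x, y) \<in> r \<longleftrightarrow> rank x < rank y" if "x \<in> F" "y \<in> F" for x y
    using less[of x y] less[of y x] that assms(4) by (auto simp: total_on_def) (metis less_asym less_irrefl)
  have inj: "inj_on rank F"
  proof (rule inj_onI)
    fix x y assume "x \<in> F" "y \<in> F" "rank x = rank y"
    then show "x = y" using iff[of x y] iff[of y x] assms(4) by (auto simp: total_on_def)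
  qed
  have "rank ` F \<subseteq> {..<card F}"
  proof
    fix n assume "n \<in> rank ` F"
    then obtain x where x: "x \<in> F" "n = rank x" by blast
    have "{z \<in> F. (z, x) \<in> r} \<subset> F" using x assms(3) by (auto simp: irrefl_def)
    then show "n \<in> {..<card F}" using x assms(1) by (simp add: rank_def psubset_card_mono)
  qed
  then have "rank ` F = {..<card F}"
    using card_image[OF inj] by (intro card_subset_eq) auto
  then show ?thesis
    unfolding order_iso_def using inj iff by (intro exI[of _ rank]) (auto simp: bij_betw_def)
qed

lemma strict_well_order_pullback:
  assumes "strict_well_order (B, s)" and "bij_betw k C B"
  defines "s' \<equiv> {(x, y). x \<in> C \<and> y \<in> C \<and> (k x, k y) \<in> s}"
  shows "strict_well_order (C, s')" and "(C, s') \<simeq>\<^sub>o (B, s)"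
proof -
  have s: "trans s" "irrefl s" "total_on B s" "wf s"
    using assms(1) by (auto simp: strict_well_order_def strict_linear_order_on_def)
  have "trans s'" using s(1) unfolding s'_def trans_def by blast
  moreover have "irrefl s'" using s(2) by (auto simp: s'_def irrefl_def)
  moreover have "total_on C s'"
    using s(3) assms(2) unfolding s'_def total_on_def bij_betw_def inj_on_def by blast
  moreover have "wf s'"
    by (rule wf_subset[OF wf_inv_image[OF s(4), of k]]) (auto simp: s'_def inv_image_def)
  moreover have "s' \<subseteq> C \<times> C" by (auto simp: s'_def)
  ultimately show "strict_well_order (C, s')"
    by (simp add: strict_well_order_def strict_linear_order_on_def)
  show "(C, s') \<simeq>\<^sub>o (B, s)"
    unfolding order_iso_def using assms(2) by (intro exI[of _ k]) (simp add: s'_def)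
qed

text \<open>The part of \<open>A\<close> below \<open>N\<close> is a finite linear order, so it is
  isomorphic to any subset of \<open>B\<close> with equally many elements. Such a subset is placed
  where \<open>A\<close> has its elements below \<open>N\<close>, and the rest of \<open>B\<close>
  is moved to \<open>N\<close> and beyond. The size hypothesis ensures that \<open>B\<close> has
  enough elements.\<close>

lemma copy_with_given_prefix:
  fixes A B :: "nat set"
  assumes A: "strict_well_order (A, r)" and B: "strict_well_order (B, s)"
    and size: "finite B \<Longrightarrow> finite A \<and> card A \<le> card B"
  obtains C t where "strict_well_order (C, t)" "(C, t) \<simeq>\<^sub>o (B, s)"
    "C \<inter> {..<N} = A \<inter> {..<N}" "\<And>a b. \<lbrakk>a < N; b < N\<rbrakk> \<Longrightarrow> (a, b) \<in> t \<longleftrightarrow> (a, b) \<in> r"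
proof -
  define F where "F = A \<inter> {..<N}"
  have r: "r \<subseteq> A \<times> A" "trans r" "irrefl r" "total_on A r"
    using A by (auto simp: strict_well_order_def strict_linear_order_on_def)
  have s: "trans s" "irrefl s" "total_on B s"
    using B by (auto simp: strict_well_order_def strict_linear_order_on_def)
  have "\<exists>T. finite T \<and> card T = card F \<and> T \<subseteq> B"
  proof (cases "finite B")
    case True
    then have "card F \<le> card B"
      using size card_mono[of A F] by (force simp: F_def)
    then show ?thesis using True by (metis obtain_subset_with_card_n)
  next
    case False
    then show ?thesis using infinite_arbitrarily_large by blast
  qed
  then obtain T where T: "finite T" "card T = card F" "T \<subseteq> B" by blast
  have "(F, r) \<simeq>\<^sub>o ({..<card F}, {(a, b). a < b})"
    using r by (intro finite_linear_order_iso_lessThan) (auto simp: F_def total_on_def)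
  moreover have "(T, s) \<simeq>\<^sub>o ({..<card T}, {(a, b). a < b})"
    using s T by (intro finite_linear_order_iso_lessThan) (auto simp: total_on_def)
  ultimately have "(F, r) \<simeq>\<^sub>o (T, s)"
    using T(2) by (metis order_iso_sym order_iso_trans)
  then obtain f where f: "bij_betw f F T"
      and f_mono: "\<And>a b. \<lbrakk>a \<in> F; b \<in> F\<rbrakk> \<Longrightarrow> (a, b) \<in> r \<longleftrightarrow> (f a, f b) \<in> s"
    by (auto simp: order_iso_def)
  \<comment> \<open>The shift by \<open>N\<close> leaves the numbers below \<open>N\<close> to
    \<open>F\<close>; the map \<open>k\<close> tells the two parts apart by comparison with
    \<open>N\<close>.\<close>
  define D where "D = (\<lambda>x. x + N) ` (B - T)"
  define k where "k x = (if x < N then f x else x - N)" for x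
  have "bij_betw k F T"
    using f by (rule iffD1[OF bij_betw_cong, rotated]) (simp add: k_def F_def)
  moreover have "bij_betw k D (B - T)"
    by (rule bij_betw_byWitness[where f' = "\<lambda>x. x + N"]) (auto simp: k_def D_def)
  ultimately have "bij_betw k (F \<union> D) (T \<union> (B - T))"
    by (rule bij_betw_combine) auto
  then have k: "bij_betw k (F \<union> D) B" using T(3) by (simp add: Un_absorb1)
  define t where "t = {(x, y). x \<in> F \<union> D \<and> y \<in> F \<union> D \<and> (k x, k y) \<in> s}"
  have F: "x \<in> F \<union> D \<longleftrightarrow> x \<in> F" if "x < N" for x using that by (auto simp: D_def)
  show ?thesis
  proof
    show "strict_well_order (F \<union> D, t)" "(F \<union> D, t) \<simeq>\<^sub>o (B, s)"
      unfolding t_def by (rule strict_well_order_pullback[OF B k])+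
    show "(F \<union> D) \<inter> {..<N} = A \<inter> {..<N}" by (auto simp: F_def D_def)
    fix a b assume ab: "a < N" "b < N"
    have "(a, b) \<in> t \<longleftrightarrow> a \<in> F \<and> b \<in> F \<and> (f a, f b) \<in> s"
      using ab F by (auto simp: t_def k_def)
    also have "\<dots> \<longleftrightarrow> a \<in> F \<and> b \<in> F \<and> (a, b) \<in> r" using f_mono by blast
    also have "\<dots> \<longleftrightarrow> (a, b) \<in> r" using r(1) ab by (auto simp: F_def)
    finally show "(a, b) \<in> t \<longleftrightarrow> (a, b) \<in> r" .
  qed
qed

text \<open>If \<open>K\<close> has a finite member, take one of least cardinality; otherwise the
  condition is vacuous and any member serves.\<close>

lemma ex_least_size:
  assumes "K \<noteq> {}"
  shows "\<exists>A\<in>K. \<forall>B\<in>K. finite B \<longrightarrow> finite A \<and> card A \<le> card B"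
proof (cases "\<exists>A\<in>K. finite A")
  case True
  then obtain A0 where "A0 \<in> K \<and> finite A0" by blast
  then obtain A where "A \<in> K \<and> finite A" "\<And>B. B \<in> K \<and> finite B \<Longrightarrow> card A \<le> card B"
    using ex_has_least_nat[of "\<lambda>A. A \<in> K \<and> finite A" A0 card] by blast
  then show ?thesis by blast
qed (use assms in blast)

section \<open>Names of solutions\<close>

text \<open>A canonical name in the output space of \<open>OG_to_alpha_eps\<close>, so that
  solutions that agree on small numbers have names that agree on a prefix.\<close>

definition solution_name :: "nat order_structure \<Rightarrow> nat \<Rightarrow> baire" where
  "solution_name \<alpha> \<epsilon> =
    join (join (\<lambda>n. of_bool (n \<in> fst \<alpha>)) (\<lambda>n. of_bool (prod_decode n \<in> snd \<alpha>))) (\<lambda>_. \<epsilon>)"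

lemma prod_rep_join:
  "\<lbrakk>\<delta> p = Some x; \<delta>' q = Some y\<rbrakk> \<Longrightarrow> prod_rep \<delta> \<delta>' (join p q) = Some (x, y)"
  by (simp add: prod_rep_def join_def)

lemma set_rep_of_bool: "set_rep (\<lambda>n. of_bool (P n)) = Some {n. P n}"
  by (auto simp: set_rep_def)

lemma rel_rep_of_bool: "rel_rep (\<lambda>n. of_bool (prod_decode n \<in> r)) = Some r"
  by (simp add: rel_rep_def set_rep_of_bool)

lemma solution_name_correct:
  assumes "strict_well_order \<alpha>" and "\<epsilon> \<in> {0, 1}"
  shows "prod_rep well_order_copy_rep bit_rep (solution_name \<alpha> \<epsilon>) = Some (\<alpha>, \<epsilon>)"
  unfolding solution_name_def
proof (rule prod_rep_join)
  have "prod_rep set_rep rel_rep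
      (join (\<lambda>n. of_bool (n \<in> fst \<alpha>)) (\<lambda>n. of_bool (prod_decode n \<in> snd \<alpha>))) = Some \<alpha>"
    using prod_rep_join[of set_rep _ "fst \<alpha>" rel_rep, OF _ rel_rep_of_bool]
    by (simp add: set_rep_of_bool)
  then show "well_order_copy_rep
      (join (\<lambda>n. of_bool (n \<in> fst \<alpha>)) (\<lambda>n. of_bool (prod_decode n \<in> snd \<alpha>))) = Some \<alpha>"
    using assms(1) by (simp add: well_order_copy_rep_def restrict_rep_def)
  show "bit_rep (\<lambda>_. \<epsilon>) = Some \<epsilon>" using assms(2) by (auto simp: bit_rep_def)
qed

text \<open>A pair code bounds both of its components, so the first \<open>N\<close> bits of the
  relation concern only numbers below \<open>N\<close>.\<close>

lemma solution_name_agree: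
  assumes "A \<inter> {..<N} = B \<inter> {..<N}"
    and "\<And>a b. \<lbrakk>a < N; b < N\<rbrakk> \<Longrightarrow> (a, b) \<in> r \<longleftrightarrow> (a, b) \<in> s"
  shows "agree_below N (solution_name (A, r) \<epsilon>) (solution_name (B, s) \<epsilon>)"
proof -
  have "agree_below N (\<lambda>n. of_bool (n \<in> A)) (\<lambda>n. of_bool (n \<in> B))"
    using assms(1) by (auto simp: agree_below_def)
  moreover have "agree_below N (\<lambda>n. of_bool (prod_decode n \<in> r)) (\<lambda>n. of_bool (prod_decode n \<in> s))"
    unfolding agree_below_def
  proof (intro allI impI)
    fix n assume "n < N"
    obtain a b where ab: "prod_decode n = (a, b)" by fastforce
    then have "n = prod_encode (a, b)" by (metis prod_decode_inverse)
    then have "a < N" "b < N"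
      using \<open>n < N\<close> le_prod_encode_1[of a b] le_prod_encode_2[of b a] by simp_all
    then show "of_bool (prod_decode n \<in> r) = (of_bool (prod_decode n \<in> s) :: nat)"
      using assms(2) by (simp add: ab)
  qed
  ultimately show ?thesis
    unfolding solution_name_def by (simp add: agree_below_join)
qed

section \<open>The reduction\<close>

text \<open>These are exactly the names of instances of \<open>C_N\<close>, that is, of nonempty
  sets.\<close>

definition proper :: "baire \<Rightarrow> bool" where
  "proper p \<longleftrightarrow> (\<exists>n. Suc n \<notin> range p)"

text \<open>After a finite prefix, \<open>n\<close> is enumerated out and then nothing more; a
  finite range cannot exhaust the positive numbers.\<close>

lemma proper_extension:
  obtains p' where "proper p'" "agree_below N p p'" "p' N = Suc n"
proof
  let ?p = "\<lambda>i. if i < N then p i else if i = N then Suc n else 0"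
  have "range ?p \<subseteq> p ` {..<N} \<union> {Suc n, 0}" by auto
  then have "finite (range ?p)" by (rule finite_subset) simp
  then have "finite (Suc -` range ?p)" by (rule finite_vimageI) simp
  then obtain m where "m \<notin> Suc -` range ?p"
    using ex_new_if_finite infinite_UNIV_nat by blast
  then show "proper ?p" unfolding proper_def by (intro exI[of _ m]) simp
qed (auto simp: agree_below_def)

text \<open>One round of the diagonal argument, with \<open>sol p\<close> standing for the solutions
  of the instance computed from \<open>p\<close>. The witness \<open>p\<close> is returned along
  with \<open>p\<^sub>1\<close> because it shows that the excluded bit still occurs near
  \<open>p\<^sub>0\<close>; this makes the bits excluded in successive rounds distinct.\<close>

lemma bit_excluded:
  fixes sol :: "baire \<Rightarrow> (nat order_structure \<times> nat) set" and p\<^sub>0 :: baire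
  assumes "computable \<Psi>"
    and wo: "\<And>p \<alpha> \<epsilon>. (\<alpha>, \<epsilon>) \<in> sol p \<Longrightarrow> strict_well_order \<alpha>"
    and copy: "\<And>p \<alpha> \<epsilon> \<beta>. \<lbrakk>(\<alpha>, \<epsilon>) \<in> sol p; strict_well_order \<beta>; \<beta> \<simeq>\<^sub>o \<alpha>\<rbrakk> \<Longrightarrow> (\<beta>, \<epsilon>) \<in> sol p"
    and nonempty: "\<And>p. proper p \<Longrightarrow> sol p \<noteq> {}"
    and correct: "\<And>p \<alpha> \<epsilon>. \<lbrakk>proper p; (\<alpha>, \<epsilon>) \<in> sol p\<rbrakk> \<Longrightarrow>
      \<exists>r. \<Psi> (join p (solution_name \<alpha> \<epsilon>)) = Some r \<and> Suc (r 0) \<notin> range p"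
    and "proper p\<^sub>0"
  obtains p\<^sub>1 M p \<alpha> \<epsilon> where "proper p\<^sub>1" "agree_below N p\<^sub>0 p\<^sub>1"
    "proper p" "agree_below N p\<^sub>0 p" "(\<alpha>, \<epsilon>) \<in> sol p"
    "\<And>p' \<alpha>'. \<lbrakk>proper p'; agree_below M p\<^sub>1 p'\<rbrakk> \<Longrightarrow> (\<alpha>', \<epsilon>) \<notin> sol p'"
proof -
  obtain e where e: "\<And>p q n. \<Psi> p = Some q \<Longrightarrow> evaluates p e [n] (q n)"
    using assms(1) unfolding computable_def by blast
  \<comment> \<open>Both bits compete in \<open>K\<close>: the bit to be excluded is the one that
    comes with the universe of least size.\<close>
  define K where "K = {A. \<exists>p r \<epsilon>. proper p \<and> agree_below N p\<^sub>0 p \<and> ((A, r), \<epsilon>) \<in> sol p}"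
  obtain A\<^sub>0 r\<^sub>0 \<epsilon>\<^sub>0 where "((A\<^sub>0, r\<^sub>0), \<epsilon>\<^sub>0) \<in> sol p\<^sub>0"
    using nonempty[OF \<open>proper p\<^sub>0\<close>] by auto
  then have "A\<^sub>0 \<in> K"
    using \<open>proper p\<^sub>0\<close> agree_below_refl[of N p\<^sub>0] unfolding K_def by blast
  then have "K \<noteq> {}" by blast
  from ex_least_size[OF this]
  obtain A where "A \<in> K" and least: "\<And>B. \<lbrakk>B \<in> K; finite B\<rbrakk> \<Longrightarrow> finite A \<and> card A \<le> card B"
    by metis
  from \<open>A \<in> K\<close> obtain p r \<epsilon> where p: "proper p" "agree_below N p\<^sub>0 p" and sol: "((A, r), \<epsilon>) \<in> sol p"
    unfolding K_def by blast
  obtain u where "\<Psi> (join p (solution_name (A, r) \<epsilon>)) = Some u"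
    using correct[OF p(1) sol] by blast
  then have "evaluates (join p (solution_name (A, r) \<epsilon>)) e [0] (u 0)" by (rule e)
  then obtain L where L: "\<And>q. agree_below L (join p (solution_name (A, r) \<epsilon>)) q \<Longrightarrow>
      evaluates q e [0] (u 0)"
    using evaluates_continuous by blast
  \<comment> \<open>The bound \<open>L\<close> preserves the computation of \<open>u 0\<close>, and
    \<open>N\<close> the agreement with \<open>p\<^sub>0\<close>; right after this prefix, the
    computed number is enumerated out.\<close>
  obtain p\<^sub>1 where p\<^sub>1: "proper p\<^sub>1" "agree_below (max L N) p p\<^sub>1" "p\<^sub>1 (max L N) = Suc (u 0)"
    by (rule proper_extension)
  show ?thesis
  proof (rule that)
    show "agree_below N p\<^sub>0 p\<^sub>1"
      using p(2) p\<^sub>1(2) by (simp add: agree_below_def)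
    fix p' \<alpha>'
    \<comment> \<open>The successor includes the position that enumerates \<open>u 0\<close>
      out.\<close>
    assume p': "proper p'" "agree_below (Suc (max L N)) p\<^sub>1 p'"
    show "(\<alpha>', \<epsilon>) \<notin> sol p'"
    proof
      assume sol': "(\<alpha>', \<epsilon>) \<in> sol p'"
      obtain B s where B: "\<alpha>' = (B, s)" by fastforce
      have pp': "agree_below (max L N) p p'"
        using p\<^sub>1(2) p'(2) by (simp add: agree_below_def)
      then have "agree_below N p\<^sub>0 p'"
        using p(2) pp' by (simp add: agree_below_def)
      \<comment> \<open>Now \<open>least\<close> yields the size hypothesis for copying
        \<open>B\<close> with the prefix of \<open>A\<close>.\<close>
      then have "B \<in> K" using p'(1) sol' unfolding K_def B by blast
      then obtain C t where C: "strict_well_order (C, t)" "(C, t) \<simeq>\<^sub>o (B, s)"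
          "C \<inter> {..<L} = A \<inter> {..<L}" "\<And>a b. \<lbrakk>a < L; b < L\<rbrakk> \<Longrightarrow> (a, b) \<in> t \<longleftrightarrow> (a, b) \<in> r"
        using copy_with_given_prefix[OF wo[OF sol] wo[OF sol'[unfolded B]] least] by metis
      have "((C, t), \<epsilon>) \<in> sol p'" using copy sol' C(1,2) unfolding B by blast
      then obtain v where v: "\<Psi> (join p' (solution_name (C, t) \<epsilon>)) = Some v" "Suc (v 0) \<notin> range p'"
        using correct p'(1) by blast
      \<comment> \<open>The bit is part of both names, so this is where its being unchanged
        matters.\<close>
      have "agree_below L (solution_name (A, r) \<epsilon>) (solution_name (C, t) \<epsilon>)"
        using C(3,4) by (intro solution_name_agree) auto
      then have "evaluates (join p' (solution_name (C, t) \<epsilon>)) e [0] (u 0)"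
        using agree_below_mono[OF pp'] by (intro L agree_below_join) auto
      then have "v 0 = u 0" using e[OF v(1)] evaluates_deterministic by blast
      moreover have "p' (max L N) = Suc (u 0)"
        using p'(2) p\<^sub>1(3) by (simp add: agree_below_def)
      ultimately show False using v(2) by (metis rangeI)
    qed
  qed (use p p\<^sub>1 sol in auto)
qed

theorem corollary2p27:
  shows "\<not> C_N \<le>\<^sub>W OG_to_alpha_eps"
proof
  assume "C_N \<le>\<^sub>W OG_to_alpha_eps"
  then obtain \<Phi> \<Psi> where "computable \<Psi>" and red:
    "\<And>p x. input_rep C_N p = Some x \<and> x \<in> problem_dom C_N \<Longrightarrow>
      \<exists>p' z. \<Phi> p = Some p' \<and> input_rep OG_to_alpha_eps p' = Some z \<and> z \<in> problem_dom OG_to_alpha_eps \<and>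
        (\<forall>q w. output_rep OG_to_alpha_eps q = Some w \<and> w \<in> solutions OG_to_alpha_eps z \<longrightarrow>
          (\<exists>r y. \<Psi> (join p q) = Some r \<and> output_rep C_N r = Some y \<and> y \<in> solutions C_N x))"
    unfolding weihrauch_reducible_def by blast
  \<comment> \<open>The uses of \<open>the\<close> are meaningful for proper \<open>p\<close>, where
    the reduction provides an instance; well-orderedness and closure under copies hold for every
    \<open>p\<close>.\<close>
  define sol where
    "sol p = solutions OG_to_alpha_eps (the (input_rep OG_to_alpha_eps (the (\<Phi> p))))" for p
  have sol_wo: "strict_well_order \<alpha> \<and> \<epsilon> \<in> {0, 1}" if "(\<alpha>, \<epsilon>) \<in> sol p" for p \<alpha> \<epsilon>
    using that by (auto simp: sol_def OG_to_alpha_eps_def split: prod.splits)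
  have copy: "(\<beta>, \<epsilon>) \<in> sol p" if "(\<alpha>, \<epsilon>) \<in> sol p" "strict_well_order \<beta>" "\<beta> \<simeq>\<^sub>o \<alpha>" for p \<alpha> \<epsilon> \<beta>
    using that has_type_ZQ_cong[OF _ that(3)]
    by (auto simp: sol_def OG_to_alpha_eps_def split: prod.splits)
  have reduction: "sol p \<noteq> {} \<and> (\<forall>\<alpha> \<epsilon>. (\<alpha>, \<epsilon>) \<in> sol p \<longrightarrow>
      (\<exists>r. \<Psi> (join p (solution_name \<alpha> \<epsilon>)) = Some r \<and> Suc (r 0) \<notin> range p))" if "proper p" for p
  proof -
    have "input_rep C_N p = Some {n. Suc n \<notin> range p} \<and> {n. Suc n \<notin> range p} \<in> problem_dom C_N"
      using that by (auto simp: C_N_def problem_dom_def co_enum_rep_def proper_def ran_def)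
    from red[OF this] obtain z where "sol p = solutions OG_to_alpha_eps z"
        "z \<in> problem_dom OG_to_alpha_eps" and z:
        "\<And>q w. \<lbrakk>output_rep OG_to_alpha_eps q = Some w; w \<in> solutions OG_to_alpha_eps z\<rbrakk> \<Longrightarrow>
          \<exists>r y. \<Psi> (join p q) = Some r \<and> output_rep C_N r = Some y \<and>
            y \<in> solutions C_N {n. Suc n \<notin> range p}"
      unfolding sol_def by fastforce
    moreover have "output_rep OG_to_alpha_eps (solution_name \<alpha> \<epsilon>) = Some (\<alpha>, \<epsilon>)"
      if "(\<alpha>, \<epsilon>) \<in> sol p" for \<alpha> \<epsilon>
      using solution_name_correct sol_wo[OF that] by (simp add: OG_to_alpha_eps_def)
    ultimately show ?thesis
      by (fastforce simp: problem_dom_def C_N_def nat_rep_def)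
  qed
  have nonempty: "sol p \<noteq> {}" if "proper p" for p
    using reduction[OF that] by blast
  have correct: "\<exists>r. \<Psi> (join p (solution_name \<alpha> \<epsilon>)) = Some r \<and> Suc (r 0) \<notin> range p"
    if "proper p" "(\<alpha>, \<epsilon>) \<in> sol p" for p \<alpha> \<epsilon>
    using reduction[OF that(1)] that(2) by blast
  have wo: "strict_well_order \<alpha>" if "(\<alpha>, \<epsilon>) \<in> sol p" for p \<alpha> \<epsilon> using sol_wo[OF that] by blast
  have excluded: "\<exists>p\<^sub>1 M p \<alpha> \<epsilon>. proper p\<^sub>1 \<and> agree_below N p\<^sub>0 p\<^sub>1 \<and>
      proper p \<and> agree_below N p\<^sub>0 p \<and> (\<alpha>, \<epsilon>) \<in> sol p \<and>
      (\<forall>p' \<alpha>'. proper p' \<and> agree_below M p\<^sub>1 p' \<longrightarrow> (\<alpha>', \<epsilon>) \<notin> sol p')"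
    if "proper p\<^sub>0" for p\<^sub>0 N
    by (rule bit_excluded[of \<Psi> sol p\<^sub>0 N, OF \<open>computable \<Psi>\<close>])
      (use wo copy nonempty correct that in blast)+
  \<comment> \<open>The starting input enumerates nothing and names the set of all numbers.\<close>
  have "proper (\<lambda>_. 0)" by (auto simp: proper_def)
  from excluded[OF this, of 0]
  obtain p\<^sub>1 M \<epsilon>\<^sub>0 p\<^sub>0 \<alpha>\<^sub>0 where p\<^sub>1: "proper p\<^sub>1" "(\<alpha>\<^sub>0, \<epsilon>\<^sub>0) \<in> sol p\<^sub>0"
      "\<And>p \<alpha>. \<lbrakk>proper p; agree_below M p\<^sub>1 p\<rbrakk> \<Longrightarrow> (\<alpha>, \<epsilon>\<^sub>0) \<notin> sol p"
    by blast
  \<comment> \<open>Keeping the first \<open>M\<close> values of \<open>p\<^sub>1\<close> preserves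
    the first exclusion throughout the second round.\<close>
  from excluded[OF p\<^sub>1(1), of M]
  obtain p\<^sub>2 M' \<epsilon>\<^sub>1 p \<alpha>\<^sub>1 where p\<^sub>2: "proper p\<^sub>2" "agree_below M p\<^sub>1 p\<^sub>2"
      "proper p" "agree_below M p\<^sub>1 p" "(\<alpha>\<^sub>1, \<epsilon>\<^sub>1) \<in> sol p"
      "\<And>p \<alpha>. \<lbrakk>proper p; agree_below M' p\<^sub>2 p\<rbrakk> \<Longrightarrow> (\<alpha>, \<epsilon>\<^sub>1) \<notin> sol p"
    by blast
  \<comment> \<open>Both exclusions apply to \<open>p\<^sub>2\<close>, yet it has a solution; its
    bit would be a third element of \<open>{0, 1}\<close>.\<close>
  obtain \<alpha> \<epsilon> where \<epsilon>: "(\<alpha>, \<epsilon>) \<in> sol p\<^sub>2" using nonempty[OF p\<^sub>2(1)] by fast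
  have "\<epsilon> \<noteq> \<epsilon>\<^sub>0" using p\<^sub>1(3)[OF p\<^sub>2(1,2)] \<epsilon> by blast
  moreover have "\<epsilon> \<noteq> \<epsilon>\<^sub>1" using p\<^sub>2(6)[OF p\<^sub>2(1) agree_below_refl] \<epsilon> by blast
  moreover have "\<epsilon>\<^sub>1 \<noteq> \<epsilon>\<^sub>0" using p\<^sub>1(3)[OF p\<^sub>2(3,4)] p\<^sub>2(5) by blast
  ultimately show False using sol_wo[OF \<epsilon>] sol_wo[OF p\<^sub>1(2)] sol_wo[OF p\<^sub>2(5)] by auto
qed

end
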